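(* Let $n \geqslant 2$, let $p > n$, let $\mathbb{B}^{n} = \{x \in \mathbb{R}^{n} : |x| < 1\}$, and let $Q: \mathbb{B}^{n} \to [0,\infty]$ be a Lebesgue measurable function. Let $f: \mathbb{B}^{n} \rightarrow \mathbb{R}^{n}$ be a ring $Q$-homeomorphism with respect to $p$-modulus at the point $x_0 = 0$ with $f(0) = 0$. Assume that there are constants $q_{0} \in (0, \infty)$, $\alpha \in [0, \infty)$ and $\varepsilon_0 \in (0,1)$ such that $$q_{x_{0}}(t) \leqslant q_{0}\,t^{-\alpha} \quad \text{for a.e. } t \in (0, \varepsilon_0),$$ where $q_{x_0}(t)$ (with $x_0 = 0$) denotes the integral mean of $Q$ over the sphere $S(0,t)$. Then $$\limsup_{x\rightarrow 0} \frac{|f(x)|}{|x|^{\frac{\alpha+p-n}{p-n}}} \geqslant \left(\frac{p-n}{\alpha+p-n}\right)^{\frac{p-1}{p-n}} q_{0}^{\frac{1}{n-p}}.$$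
   Context: For a family $\Gamma$ of curves $\gamma$ in $\mathbb{R}^{n}$, a Borel measurable function $\rho: \mathbb{R}^{n} \to [0,\infty]$ is called admissible for $\Gamma$ (written $\rho \in \mathrm{adm}\,\Gamma$) if $\int_{\gamma} \rho(x)\,ds \geqslant 1$ for all locally rectifiable $\gamma \in \Gamma$, where $ds$ denotes integration with respect to arc length. For $p \in (1,\infty)$, the $p$-modulus of $\Gamma$ is $$M_p(\Gamma) = \inf_{\rho \in \mathrm{adm}\,\Gamma} \int_{\mathbb{R}^{n}} \rho^{p}(x)\,dm(x),$$ where $dm(x)$ is the Lebesgue measure in $\mathbb{R}^{n}$. For sets $E, F, G \subset \mathbb{R}^{n}$, $\Delta(E,F,G)$ denotes the set of all continuous curves $\gamma: [a,b] \to \mathbb{R}^{n}$ with $\gamma(a) \in E$, $\gamma(b) \in F$ and $\gamma(t) \in G$ for $a < t < b$. Let $D$ be a domain in $\mathbb{R}^{n}$, $x_0 \in D$, $d_0 = \mathrm{dist}(x_0, \partial D)$. Put $\mathbb{A}(x_0,r_1,r_2) = \{x \in \mathbb{R}^{n} : r_1 < |x-x_0| < r_2\}$, $S(x_0,r) = \{x \in \mathbb{R}^{n} : |x-x_0| = r\}$ and $S_i = S(x_0,r_i)$, $i=1,2$. Let $Q: D \to [0,\infty]$ be Lebesgue measurable. A homeomorphism $f: D \to \mathbb{R}^{n}$ (i.e. a homeomorphism of $D$ onto its image $fD = f(D)$) is called a ring $Q$-homeomorphism with respect to $p$-modulus at $x_0 \in D$ if $$M_p(\Delta(fS_1, fS_2,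 fD)) \leqslant \int_{\mathbb{A}} Q(x)\,\eta^{p}(|x-x_0|)\,dm(x)$$ holds for every ring $\mathbb{A} = \mathbb{A}(x_0,r_1,r_2)$ with $0 < r_1 < r_2 < d_0$ and every measurable function $\eta: (r_1,r_2) \to [0,\infty]$ such that $\int_{r_1}^{r_2} \eta(r)\,dr = 1$. The integral mean of $Q$ over the sphere $S(x_0,r)$ is $$q_{x_0}(r) = \frac{1}{\omega_{n-1}\, r^{n-1}} \int_{S(x_0,r)} Q(x)\,d\mathcal{A},$$ where $\omega_{n-1}$ is the area of the unit sphere in $\mathbb{R}^{n}$ and $d\mathcal{A}$ is the element of surface area. *)

theory Defs
  imports "HOL-Analysis.Analysis"
begin

text \<open>Powers with values in \<open>[0,\<infinity>]\<close>, used for exponents \<open>p > 0\<close> only.\<close>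

definition ennpowr :: "ennreal \<Rightarrow> real \<Rightarrow> ennreal" where
  "ennpowr x p = (if x = \<infinity> then \<infinity> else ennreal (enn2real x powr p))"

section \<open>Curves, arc length and line integrals\<close>

text \<open>A curve is a pair of a parameter interval and a map; the values of the map outside
  the interval are irrelevant.\<close>

type_synonym 'a curve = "real set \<times> (real \<Rightarrow> 'a)"

definition is_curve :: "'a::topological_space curve \<Rightarrow> bool" where
  "is_curve c \<longleftrightarrow> is_interval (fst c) \<and> fst c \<noteq> {} \<and> continuous_on (fst c) (snd c)"

text \<open>The length of \<open>g\<close> over \<open>[a,b]\<close>: the supremum over all finite increasing sequences of
  parameters of the lengths of the inscribed polygons.\<close>

definition arc_length :: "(real \<Rightarrow> 'a::metric_space) \<Rightarrow> real \<Rightarrow> real \<Rightarrow> ennreal" where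
  "arc_length g a b =
     (SUP ts \<in> {ts. sorted ts \<and> set ts \<subseteq> {a..b}}.
        \<Sum>i<length ts - 1. ennreal (dist (g (ts ! i)) (g (ts ! Suc i))))"

definition locally_rectifiable :: "'a::metric_space curve \<Rightarrow> bool" where
  "locally_rectifiable c \<longleftrightarrow>
     (\<forall>a b. a \<le> b \<longrightarrow> {a..b} \<subseteq> fst c \<longrightarrow> arc_length (snd c) a b < \<infinity>)"

text \<open>The parametrization of a rectifiable \<open>g\<close> on \<open>[a,b]\<close> by arc length. The parameter \<open>t\<close> need
  not be unique, but \<open>g\<close> takes the same value at all parameters admitted here.\<close>

definition arc_length_param :: "(real \<Rightarrow> 'a::metric_space) \<Rightarrow> real \<Rightarrow> real \<Rightarrow> real \<Rightarrow> 'a" where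
  "arc_length_param g a b s = g (SOME t. t \<in> {a..b} \<and> arc_length g a t = ennreal s)"

definition segment_integral ::
    "('a::metric_space \<Rightarrow> ennreal) \<Rightarrow> (real \<Rightarrow> 'a) \<Rightarrow> real \<Rightarrow> real \<Rightarrow> ennreal" where
  "segment_integral \<rho> g a b =
     (\<integral>\<^sup>+s\<in>{0..enn2real (arc_length g a b)}. \<rho> (arc_length_param g a b s) \<partial>lborel)"

text \<open>For a locally rectifiable curve the line integral is the supremum over all compact
  subcurves; if the parameter interval is compact, this is the integral over the whole curve.\<close>

definition line_integral :: "('a::metric_space \<Rightarrow> ennreal) \<Rightarrow> 'a curve \<Rightarrow> ennreal" where
  "line_integral \<rho> c =
     (SUP (a, b) \<in> {(a, b). a \<le> b \<and> {a..b} \<subseteq> fst c}. segment_integral \<rho> (snd c) a b)"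

section \<open>The modulus of a family of curves\<close>

definition admissible :: "'a::metric_space curve set \<Rightarrow> ('a \<Rightarrow> ennreal) set" where
  "admissible \<Gamma> = {\<rho> \<in> borel_measurable borel.
     \<forall>c\<in>\<Gamma>. locally_rectifiable c \<longrightarrow> 1 \<le> line_integral \<rho> c}"

definition modulus :: "real \<Rightarrow> 'a::euclidean_space curve set \<Rightarrow> ennreal" where
  "modulus p \<Gamma> = (INF \<rho>\<in>admissible \<Gamma>. \<integral>\<^sup>+x. ennpowr (\<rho> x) p \<partial>lebesgue)"

definition joining_curves ::
    "'a::metric_space set \<Rightarrow> 'a set \<Rightarrow> 'a set \<Rightarrow> 'a curve set" ("\<Delta>") where
  "\<Delta> E F G = {c. is_curve c \<and> (\<exists>a b. a < b \<and> fst c = {a..b} \<and>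
     snd c a \<in> E \<and> snd c b \<in> F \<and> (\<forall>t. a < t \<and> t < b \<longrightarrow> snd c t \<in> G))}"

section \<open>Ring Q-homeomorphisms\<close>

definition spherical_ring :: "'a::metric_space \<Rightarrow> real \<Rightarrow> real \<Rightarrow> 'a set" where
  "spherical_ring x0 r1 r2 = {x. r1 < dist x x0 \<and> dist x x0 < r2}"

text \<open>Extended-real valued, so that the distance to an empty boundary is \<open>\<infinity>\<close>
  (\<open>infdist\<close> would give 0).\<close>

definition boundary_dist :: "'a::metric_space \<Rightarrow> 'a set \<Rightarrow> ereal" where
  "boundary_dist x0 D = (INF y\<in>frontier D. ereal (dist x0 y))"

definition ring_Q_homeomorphism ::
    "real \<Rightarrow> 'a::euclidean_space set \<Rightarrow> ('a \<Rightarrow> ennreal) \<Rightarrow> 'a \<Rightarrow> ('a \<Rightarrow> 'a) \<Rightarrow> bool" where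
  "ring_Q_homeomorphism p D Q x0 f \<longleftrightarrow>
     (\<exists>g. homeomorphism D (f ` D) f g) \<and>
     (\<forall>r1 r2 \<eta>. 0 < r1 \<longrightarrow> r1 < r2 \<longrightarrow> ereal r2 < boundary_dist x0 D \<longrightarrow>
        \<eta> \<in> borel_measurable (lebesgue_on {r1<..<r2}) \<longrightarrow>
        (\<integral>\<^sup>+r\<in>{r1<..<r2}. \<eta> r \<partial>lebesgue) = 1 \<longrightarrow>
        modulus p (\<Delta> (f ` sphere x0 r1) (f ` sphere x0 r2) (f ` D))
          \<le> (\<integral>\<^sup>+x\<in>spherical_ring x0 r1 r2. Q x * ennpowr (\<eta> (dist x x0)) p \<partial>lebesgue))"

section \<open>Surface area on spheres and integral means\<close>

text \<open>The library has no surface measure. On \<open>sphere c r\<close> (with \<open>r > 0\<close>) the area of \<open>A\<close> is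
  \<open>n / r\<close> times the volume of the cone \<open>{c + t *\<^sub>R (y - c) | y t. y \<in> A \<and> 0 < t \<and> t < 1}\<close>; equivalently,
  it is the image under radial projection of \<open>n / r\<close> times Lebesgue measure on the ball. The
  measure is completed, as \<open>Q\<close> is only Lebesgue measurable. As a measure on the whole space it
  is concentrated on the sphere; the centre, which the projection fixes, has measure 0.\<close>

definition sphere_area :: "'a::euclidean_space \<Rightarrow> real \<Rightarrow> 'a measure" where
  "sphere_area c r = completion (distr
     (density lborel (\<lambda>x. ennreal (real DIM('a) / r) * indicator (ball c r) x))
     borel (\<lambda>x. c + (r / norm (x - c)) *\<^sub>R (x - c)))"

definition unit_sphere_area :: "'a::euclidean_space itself \<Rightarrow> ennreal" where
  "unit_sphere_area _ = emeasure (sphere_area (0::'a) 1) (sphere 0 1)"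

definition sphere_mean :: "('a::euclidean_space \<Rightarrow> ennreal) \<Rightarrow> 'a \<Rightarrow> real \<Rightarrow> ennreal" where
  "sphere_mean Q x0 r = (\<integral>\<^sup>+x\<in>sphere x0 r. Q x \<partial>sphere_area x0 r)
     / (unit_sphere_area TYPE('a) * ennreal (r ^ (DIM('a) - 1)))"

end

(* Let L be the maximum of |f| on the sphere S of radius r. Every ray from 0 leaves the image of the
   ball inside S at distance at most L, so it contains a segment of length less than L that joins the
   images of S and of any smaller concentric sphere. A one-dimensional Hoelder estimate along these
   rays, integrated over all directions, bounds the modulus from below by a multiple of L to the
   power n - p. The ring Q-inequality with the density eta(t) proportional to t^((alpha+1-n)/(p-1))
   bounds it from above by the radii alone. The lower bound for L follows as the smaller radius
   tends to 0. *)
theory Submission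
  imports Defs
begin

section \<open>Polar coordinates\<close>

text \<open>The assumption p > n enters through delta = (p - n) / (p - 1) > 0. The density s^(-(n -
  1) / (p - 1)), extremal along a ray, is then integrable at 0, with integral L^delta / delta over
  (0, L]. The lower bound for the modulus is therefore insensitive to where a segment starts, and
  nothing has to be known about the image of the inner sphere. The density eta is extremal too: once
  the means of Q are replaced by their bound, it minimises the right-hand side of the ring
  inequality. With gamma = (alpha + p - n) / (p - 1) and omega the area of the unit sphere, the two
  bounds get the same shape, omega * (L^delta / delta)^(1 - p) and omega * q0 * ((r2^gamma -
  r1^gamma) / gamma)^(1 - p). Thus omega cancels, gamma / delta is the exponent of |x| in the claim,
  and (delta / gamma)^(1 / delta) is the first factor of its constant. Since surface area is defined
  by projecting volume, every integral over directions is written as an integral over the unit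
  ball.\<close>

lemma nn_integral_lborel_scaleR:
  fixes g :: "'a::euclidean_space \<Rightarrow> ennreal"
  assumes [measurable]: "g \<in> borel_measurable borel" and c: "c > 0"
  shows "(\<integral>\<^sup>+x. g x \<partial>lborel) = ennreal (c ^ DIM('a)) * (\<integral>\<^sup>+x. g (c *\<^sub>R x) \<partial>lborel)"
  using c by (subst lborel_affine[of c 0])
    (simp_all add: nn_integral_density nn_integral_distr nn_integral_cmult)

text \<open>Rescaling by \<open>r\<close> turns the factor \<open>DIM('a) / r\<close> of the
  definition into \<open>DIM('a) * r ^ (DIM('a) - 1)\<close> and makes the domain of integration
  independent of \<open>r\<close>. This prepares both measurability in \<open>r\<close> and the
  exchange of integrals.\<close>

lemma nn_integral_sphere_area:
  fixes g :: "'a::euclidean_space \<Rightarrow> ennreal"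
  assumes [measurable]: "g \<in> borel_measurable borel" and r: "r > 0"
  shows "(\<integral>\<^sup>+x. g x \<partial>sphere_area 0 r) =
    (\<integral>\<^sup>+x\<in>ball 0 1. ennreal (real DIM('a) * r ^ (DIM('a) - 1)) * g ((r / norm x) *\<^sub>R x) \<partial>lborel)"
proof -
  have [measurable]: "ball (0::'a) r \<in> sets borel" by simp
  have "(\<integral>\<^sup>+x. g x \<partial>sphere_area 0 r) =
      (\<integral>\<^sup>+x. ennreal (real DIM('a) / r) * indicator (ball 0 r) x * g ((r / norm x) *\<^sub>R x) \<partial>lborel)"
    unfolding sphere_area_def
    by (subst nn_integral_completion, subst nn_integral_distr, measurable,
        subst nn_integral_density, measurable)
  also have "\<dots> = ennreal (r ^ DIM('a)) * (\<integral>\<^sup>+x. ennreal (real DIM('a) / r) *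
      indicator (ball 0 r) (r *\<^sub>R x) * g ((r / norm (r *\<^sub>R x)) *\<^sub>R (r *\<^sub>R x)) \<partial>lborel)"
    by (rule nn_integral_lborel_scaleR) (use r in measurable)
  also have "\<dots> = (\<integral>\<^sup>+x. ennreal (r ^ DIM('a)) * (ennreal (real DIM('a) / r) *
      indicator (ball 0 r) (r *\<^sub>R x) * g ((r / norm (r *\<^sub>R x)) *\<^sub>R (r *\<^sub>R x))) \<partial>lborel)"
    by (rule nn_integral_cmult[symmetric]) measurable
  also have "\<dots> = (\<integral>\<^sup>+x\<in>ball 0 1. ennreal (real DIM('a) * r ^ (DIM('a) - 1)) * g ((r / norm x) *\<^sub>R x) \<partial>lborel)"
  proof (rule nn_integral_cong)
    fix x :: 'a
    have "r ^ DIM('a) * (real DIM('a) / r) = real DIM('a) * r ^ (DIM('a) - 1)"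
      using r by (cases "DIM('a)") auto
    then have area: "ennreal (r ^ DIM('a)) * ennreal (real DIM('a) / r) = ennreal (real DIM('a) * r ^ (DIM('a) - 1))"
      using r by (simp flip: ennreal_mult')
    have ind: "indicator (ball 0 r) (r *\<^sub>R x) = (indicator (ball 0 1) x :: ennreal)"
      using r by (auto simp: indicator_def)
    have proj: "(r / norm (r *\<^sub>R x)) *\<^sub>R (r *\<^sub>R x) = (r / norm x) *\<^sub>R x"
      using r by simp
    show "ennreal (r ^ DIM('a)) * (ennreal (real DIM('a) / r) *
      indicator (ball 0 r) (r *\<^sub>R x) * g ((r / norm (r *\<^sub>R x)) *\<^sub>R (r *\<^sub>R x)))
      = ennreal (real DIM('a) * r ^ (DIM('a) - 1)) * g ((r / norm x) *\<^sub>R x) * indicator (ball 0 1) x"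
      unfolding ind proj area[symmetric] by (simp only: mult_ac)
  qed
  finally show ?thesis .
qed

text \<open>For polar coordinates: the scales \<open>s\<close> for which \<open>y / s\<close> lies
  in the unit ball are those with \<open>norm y < s\<close>. Weighted by
  \<open>n / s ^ Suc n\<close> they have total mass \<open>1 / norm y ^ n\<close>, so a factor
  \<open>norm y ^ n\<close> normalises this to 1.\<close>

lemma nn_integral_inverse_power:
  fixes a :: real
  assumes "a > 0" "n > 0"
  shows "(\<integral>\<^sup>+s\<in>{a<..}. ennreal (real n / s ^ Suc n) \<partial>lborel) = ennreal (1 / a ^ n)"
proof -
  let ?f = "\<lambda>s::real. if s < a then 0 else real n / s ^ Suc n"
  have "(\<integral>\<^sup>+s\<in>{a<..}. ennreal (real n / s ^ Suc n) \<partial>lborel) = (\<integral>\<^sup>+s. ennreal (?f s) * indicator {a..} s \<partial>lborel)"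
    using AE_lborel_singleton[of a]
    by (intro nn_integral_cong_AE, eventually_elim) (auto simp: indicator_def)
  also have "\<dots> = ennreal (0 - (- (1 / a ^ n)))"
  proof (rule nn_integral_FTC_atLeast[where F = "\<lambda>s. - (1 / s ^ n)"])
    show "DERIV (\<lambda>s. - (1 / s ^ n)) x :> ?f x" if "a \<le> x" for x
    proof -
      have "((\<lambda>s. - (1 / s ^ n)) has_real_derivative real n * x ^ (n - 1) / (x ^ n * x ^ n)) (at x)"
        using that assms by (auto intro!: derivative_eq_intros)
      moreover have "real n * x ^ (n - 1) / (x ^ n * x ^ n) = ?f x"
        using that assms by (cases n) (auto simp: divide_simps)
      ultimately show ?thesis by (simp only:)
    qed
    show "((\<lambda>s::real. - (1 / s ^ n)) \<longlongrightarrow> 0) at_top"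
    proof -
      have "((\<lambda>s::real. inverse (s ^ n)) \<longlongrightarrow> 0) at_top"
        using assms by (intro tendsto_inverse_0_at_top filterlim_pow_at_top filterlim_ident)
      from tendsto_minus[OF this] show ?thesis by (simp add: inverse_eq_divide)
    qed
  qed (use assms in auto)
  finally show ?thesis by simp
qed

text \<open>Substituting \<open>t = s * norm x\<close> in the inner integral and then \<open>y = s *\<^sub>R x\<close> after exchanging
  the integrals reduces the claim to \<open>nn_integral_inverse_power\<close>; no surface measure is needed.\<close>

lemma nn_integral_polar:
  fixes g :: "'a::euclidean_space \<Rightarrow> ennreal"
  assumes [measurable]: "g \<in> borel_measurable borel"
  shows "(\<integral>\<^sup>+x. g x \<partial>lborel) = (\<integral>\<^sup>+x\<in>ball 0 1. (\<integral>\<^sup>+t\<in>{0<..}.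
      ennreal (real DIM('a) * t ^ (DIM('a) - 1)) * g ((t / norm x) *\<^sub>R x) \<partial>lborel) \<partial>lborel)"
proof -
  define n where "n = DIM('a)"
  have n: "n > 0" by (simp add: n_def)
  \<comment> \<open>\<open>F\<close> is the integrand after both substitutions, without the Jacobian
    \<open>s ^ n\<close> of \<open>y = s *\<^sub>R x\<close>. The condition
    \<open>norm x < 1\<close> becomes \<open>norm y < s\<close>, and
    \<open>norm x * n * (norm x * s) ^ (n - 1)\<close> becomes
    \<open>s ^ n * (n / s ^ Suc n * norm y ^ n)\<close>.\<close>
  define F :: "real \<Rightarrow> 'a \<Rightarrow> ennreal" where
    "F s y = indicator {norm y<..} s * ennreal (real n / s ^ Suc n * norm y ^ n) * g y" for s y
  have F_measurable: "(\<lambda>(s, y). F s y) \<in> borel_measurable (borel \<Otimes>\<^sub>M borel)"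
  proof -
    have "F s y = (if norm y < s then ennreal (real n / s ^ Suc n * norm y ^ n) * g y else 0)" for s y
      by (simp add: F_def)
    then show ?thesis by (simp only:) measurable
  qed
  have F_meas2[measurable]: "F s \<in> borel_measurable borel" for s
    using measurable_compose[OF measurable_Pair1' F_measurable, of s] by simp
  have "(\<integral>\<^sup>+x\<in>ball 0 1. (\<integral>\<^sup>+t\<in>{0<..}.
      ennreal (real n * t ^ (n - 1)) * g ((t / norm x) *\<^sub>R x) \<partial>lborel) \<partial>lborel)
    = (\<integral>\<^sup>+x. (\<integral>\<^sup>+s\<in>{0<..}. ennreal (s ^ n) * F s (s *\<^sub>R x) \<partial>lborel) \<partial>lborel)"
  proof (rule nn_integral_cong_AE, use AE_lborel_singleton[of 0] in eventually_elim)
    fix x :: 'a assume x: "x \<noteq> 0"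
    have "(\<integral>\<^sup>+t\<in>{0<..}. ennreal (real n * t ^ (n - 1)) * g ((t / norm x) *\<^sub>R x) \<partial>lborel)
      = ennreal (norm x) * (\<integral>\<^sup>+s. ennreal (real n * (norm x * s) ^ (n - 1)) *
          g (((norm x * s) / norm x) *\<^sub>R x) * indicator {0<..} (norm x * s) \<partial>lborel)"
      using x by (subst nn_integral_real_affine[where c = "norm x" and t = 0]) auto
    also have "\<dots> = (\<integral>\<^sup>+s. ennreal (norm x) * (ennreal (real n * (norm x * s) ^ (n - 1)) *
          g (((norm x * s) / norm x) *\<^sub>R x) * indicator {0<..} (norm x * s)) \<partial>lborel)"
      by (rule nn_integral_cmult[symmetric]) measurable
    finally have "(\<integral>\<^sup>+t\<in>{0<..}. ennreal (real n * t ^ (n - 1)) * g ((t / norm x) *\<^sub>R x) \<partial>lborel) * indicator (ball 0 1) x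
      = (\<integral>\<^sup>+s. ennreal (norm x) * (ennreal (real n * (norm x * s) ^ (n - 1)) *
          g (((norm x * s) / norm x) *\<^sub>R x) * indicator {0<..} (norm x * s)) * indicator (ball 0 1) x \<partial>lborel)"
      by (simp add: nn_integral_multc)
    also have "\<dots> = (\<integral>\<^sup>+s\<in>{0<..}. ennreal (s ^ n) * F s (s *\<^sub>R x) \<partial>lborel)"
    proof (rule nn_integral_cong)
      fix s :: real
      show "ennreal (norm x) * (ennreal (real n * (norm x * s) ^ (n - 1)) *
          g (((norm x * s) / norm x) *\<^sub>R x) * indicator {0<..} (norm x * s)) * indicator (ball 0 1) x
        = ennreal (s ^ n) * F s (s *\<^sub>R x) * indicator {0<..} s"
      proof (cases "s > 0 \<and> norm x < 1")
        case True
        have "norm x * (real n * (norm x * s) ^ (n - 1)) = s ^ n * (real n / s ^ Suc n * norm (s *\<^sub>R x) ^ n)"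
          using True n by (cases n) (auto simp: field_simps)
        then have "ennreal (norm x) * ennreal (real n * (norm x * s) ^ (n - 1))
            = ennreal (s ^ n) * ennreal (real n / s ^ Suc n * norm (s *\<^sub>R x) ^ n)"
          using True by (simp flip: ennreal_mult del: norm_scaleR)
        then show ?thesis
          using True x by (simp add: F_def flip: mult.assoc)
      next
        case False
        then show ?thesis using x by (auto simp: F_def indicator_def zero_less_mult_iff)
      qed
    qed
    finally show "(\<integral>\<^sup>+t\<in>{0<..}. ennreal (real n * t ^ (n - 1)) * g ((t / norm x) *\<^sub>R x) \<partial>lborel) * indicator (ball 0 1) x
      = (\<integral>\<^sup>+s\<in>{0<..}. ennreal (s ^ n) * F s (s *\<^sub>R x) \<partial>lborel)" .
  qed
  also have "\<dots> = (\<integral>\<^sup>+s. \<integral>\<^sup>+x. ennreal (s ^ n) * F s (s *\<^sub>R x) * indicator {0<..} s \<partial>lborel \<partial>lborel)"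
  proof (rule lborel_pair.Fubini')
    have "(\<lambda>z. (fst z, fst z *\<^sub>R snd z)) \<in> borel \<Otimes>\<^sub>M (borel :: 'a measure) \<rightarrow>\<^sub>M borel \<Otimes>\<^sub>M borel"
      by measurable
    from measurable_compose[OF this F_measurable]
    have [measurable]: "(\<lambda>z. F (fst z) (fst z *\<^sub>R snd z)) \<in> borel_measurable (borel \<Otimes>\<^sub>M borel)"
      by simp
    show "(\<lambda>(s, x). ennreal (s ^ n) * F s (s *\<^sub>R x) * indicator {0<..} s)
        \<in> borel_measurable (lborel \<Otimes>\<^sub>M (lborel :: 'a measure))"
      by (simp add: case_prod_unfold cong: measurable_cong_sets) 
  qed
  also have "\<dots> = (\<integral>\<^sup>+s. \<integral>\<^sup>+y. F s y \<partial>lborel \<partial>lborel)"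
  proof (rule nn_integral_cong)
    fix s :: real
    show "(\<integral>\<^sup>+x. ennreal (s ^ n) * F s (s *\<^sub>R x) * indicator {0<..} s \<partial>lborel) = (\<integral>\<^sup>+y. F s y \<partial>lborel)"
    proof (cases "s > 0")
      case True
      then show ?thesis
        using nn_integral_lborel_scaleR[of "F s" s] by (simp add: nn_integral_cmult n_def)
    next
      case False
      then have "F s y = 0" for y by (auto simp: F_def indicator_def dest: order_le_less_trans[OF norm_ge_zero])
      with False show ?thesis by simp
    qed
  qed
  also have "\<dots> = (\<integral>\<^sup>+y. \<integral>\<^sup>+s. F s y \<partial>lborel \<partial>lborel)"
    using F_measurable by (intro lborel_pair.Fubini'[symmetric]) (simp cong: measurable_cong_sets add: case_prod_unfold lborel_pair.Fubini')
  also have "\<dots> = (\<integral>\<^sup>+y. g y \<partial>lborel)"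
  proof (rule nn_integral_cong_AE, use AE_lborel_singleton[of 0] in eventually_elim)
    fix y :: 'a assume y: "y \<noteq> 0"
    have "(\<integral>\<^sup>+s. F s y \<partial>lborel) = (\<integral>\<^sup>+s. ennreal (real n / s ^ Suc n) * indicator {norm y<..} s * (ennreal (norm y ^ n) * g y) \<partial>lborel)"
    proof (rule nn_integral_cong)
      fix s :: real
      show "F s y = ennreal (real n / s ^ Suc n) * indicator {norm y<..} s * (ennreal (norm y ^ n) * g y)"
      proof (cases "s > norm y")
        case True
        then have "s > 0" using norm_ge_zero[of y] by linarith
        then have "ennreal (real n / s ^ Suc n * norm y ^ n) = ennreal (real n / s ^ Suc n) * ennreal (norm y ^ n)"
          by (intro ennreal_mult) auto
        with True show ?thesis by (simp add: F_def mult.assoc del: power_Suc)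
      qed (simp add: F_def)
    qed
    also have "\<dots> = ennreal (1 / norm y ^ n) * (ennreal (norm y ^ n) * g y)"
      using y n by (subst nn_integral_multc) (auto simp: nn_integral_inverse_power simp del: power_Suc)
    also have "\<dots> = g y"
      using y by (simp flip: mult.assoc ennreal_mult)
    finally show "(\<integral>\<^sup>+s. F s y \<partial>lborel) = g y" .
  qed
  finally show ?thesis by (simp add: n_def)
qed

text \<open>Polar coordinates with the integrals exchanged: at a fixed radius the integral over the
  ball of directions is the area integral of \<open>nn_integral_sphere_area\<close>.\<close>

lemma nn_integral_spheres:
  fixes g :: "'a::euclidean_space \<Rightarrow> ennreal"
  assumes [measurable]: "g \<in> borel_measurable borel"
  shows "(\<integral>\<^sup>+x. g x \<partial>lborel) = (\<integral>\<^sup>+t\<in>{0<..}. (\<integral>\<^sup>+x. g x \<partial>sphere_area 0 t) \<partial>lborel)"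
proof -
  have [measurable]: "ball (0::'a) 1 \<in> sets borel" by simp
  let ?h = "\<lambda>x t. ennreal (real DIM('a) * t ^ (DIM('a) - 1)) * g ((t / norm x) *\<^sub>R x)"
  have "(\<integral>\<^sup>+x. g x \<partial>lborel)
    = (\<integral>\<^sup>+x. \<integral>\<^sup>+t. ?h x t * indicator {0<..} t * indicator (ball 0 1) x \<partial>lborel \<partial>lborel)"
    unfolding nn_integral_polar[OF assms]
    by (intro nn_integral_cong nn_integral_multc[symmetric]) measurable
  also have "\<dots> = (\<integral>\<^sup>+t. \<integral>\<^sup>+x. ?h x t * indicator {0<..} t * indicator (ball 0 1) x \<partial>lborel \<partial>lborel)"
    by (rule lborel_pair.Fubini') (simp add: case_prod_unfold cong: measurable_cong_sets)
  also have "\<dots> = (\<integral>\<^sup>+t\<in>{0<..}. (\<integral>\<^sup>+x. g x \<partial>sphere_area 0 t) \<partial>lborel)"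
    by (intro nn_integral_cong) (auto simp: indicator_def nn_integral_sphere_area intro!: nn_integral_cong)
  finally show ?thesis .
qed

text \<open>A Borel null set containing the exceptional points has volume equal to the integral of
  its areas on spheres, so almost all of these areas vanish. This carries the passage from a
  Lebesgue measurable function to a Borel representative over to almost every sphere.\<close>

lemma AE_sphere_area:
  assumes "AE x in lborel. P (x :: 'a::euclidean_space)"
  shows "AE t in lborel. 0 < t \<longrightarrow> (AE x in sphere_area 0 t. P x)"
proof -
  from AE_E[OF assms] obtain N where N: "{x. \<not> P x} \<subseteq> N" "emeasure lborel N = 0" "N \<in> sets lborel"
    by auto
  then have [measurable]: "N \<in> sets borel" by simp
  \<comment> \<open>On the fixed unit ball the area becomes an integral depending on the parameter
    \<open>t\<close>, hence measurable in \<open>t\<close>. The formula is valid for positive radii,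
    which is why the indicator is carried along.\<close>
  have meas: "(\<lambda>t. emeasure (sphere_area 0 t) N * indicator {0<..} t) \<in> borel_measurable lborel"
  proof -
    have "emeasure (sphere_area 0 t) N * indicator {0<..} t =
      (\<integral>\<^sup>+x. indicator {0<..} t * (indicator (ball 0 1) x * (ennreal (real DIM('a) * t ^ (DIM('a) - 1)) * indicator N ((t / norm x) *\<^sub>R x))) \<partial>(lborel :: 'a measure))" for t
    proof (cases "t > 0")
      case True
      have "emeasure (sphere_area 0 t) N = (\<integral>\<^sup>+x. indicator N x \<partial>sphere_area 0 t)"
        by (rule nn_integral_indicator[symmetric]) (simp add: sphere_area_def)
      then show ?thesis using True by (simp add: nn_integral_sphere_area mult_ac)
    qed simp
    moreover have [measurable]: "ball (0::'a) 1 \<in> sets borel" by simp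
    ultimately show ?thesis
      by (simp only: measurable_lborel2) measurable
  qed
  have "(\<integral>\<^sup>+t\<in>{0<..}. emeasure (sphere_area 0 t) N \<partial>lborel) = 0"
    using nn_integral_spheres[of "indicator N"] N by (simp add: sphere_area_def)
  with meas have "AE t in lborel. emeasure (sphere_area 0 t) N * indicator {0<..} t = 0"
    by (simp add: nn_integral_0_iff_AE)
  then show ?thesis
  proof (eventually_elim, intro impI)
    fix t :: real assume t: "emeasure (sphere_area 0 t) N * indicator {0<..} t = 0" "0 < t"
    then show "AE x in sphere_area 0 t. P x"
      using N by (intro AE_I[of _ _ N]) (auto simp: sphere_area_def)
  qed
qed

lemma AE_sphere_area_in_sphere:
  assumes "0 < t"
  shows "AE x in sphere_area (0::'a::euclidean_space) t. x \<in> sphere 0 t"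
proof -
  have "(\<integral>\<^sup>+x. indicator (- sphere 0 t) x \<partial>sphere_area (0::'a) t) = (\<integral>\<^sup>+x. 0 \<partial>(lborel :: 'a measure))"
  proof (subst nn_integral_sphere_area)
    show "(\<integral>\<^sup>+x\<in>ball (0::'a) 1. ennreal (real DIM('a) * t ^ (DIM('a) - 1)) *
        indicator (- sphere 0 t) ((t / norm x) *\<^sub>R x) \<partial>lborel) = (\<integral>\<^sup>+x. 0 \<partial>(lborel :: 'a measure))"
      \<comment> \<open>The origin is the one point of the ball that the projection does not send to
        the sphere, and it is a null set.\<close>
      by (rule nn_integral_cong_AE, use AE_lborel_singleton[of "0::'a"] in eventually_elim)
        (use assms in auto)
  qed (use assms in auto)
  moreover have "- sphere 0 t \<in> sets (sphere_area (0::'a) t)"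
    by (simp add: sphere_area_def)
  ultimately have "emeasure (sphere_area (0::'a) t) (- sphere 0 t) = 0"
    by simp
  with \<open>- sphere 0 t \<in> _\<close> show ?thesis
    by (intro AE_I[of _ _ "- sphere 0 t"]) auto
qed

section \<open>Total area of the unit sphere\<close>

lemma unit_sphere_area_eq:
  "unit_sphere_area TYPE('a::euclidean_space) = ennreal (DIM('a)) * emeasure lborel (ball (0::'a) 1)"
proof -
  have S: "sphere 0 1 \<in> sets (sphere_area (0::'a) 1)"
    by (simp add: sphere_area_def)
  have "unit_sphere_area TYPE('a) = (\<integral>\<^sup>+x. indicator (sphere 0 1) x \<partial>sphere_area (0::'a) 1)"
    unfolding unit_sphere_area_def using S by simp
  also have "\<dots> = (\<integral>\<^sup>+x. 1 \<partial>sphere_area (0::'a) 1)"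
    using AE_sphere_area_in_sphere[of 1, where 'a = 'a]
    by (intro nn_integral_cong_AE) (auto simp: indicator_def)
  also have "\<dots> = ennreal (DIM('a)) * emeasure lborel (ball (0::'a) 1)"
    by (subst nn_integral_sphere_area) (auto simp: nn_integral_cmult_indicator)
  finally show ?thesis .
qed

text \<open>The area of the unit sphere is a factor of both modulus bounds and of the divisor in the
  integral mean. Being neither 0 nor infinite, it can be cancelled in [0,\<infinity>].\<close>

lemma unit_sphere_area_nonzero: "unit_sphere_area TYPE('a::euclidean_space) \<noteq> 0"
  by (simp add: unit_sphere_area_eq emeasure_ball less_imp_neq[OF unit_ball_vol_pos, symmetric])

lemma unit_sphere_area_finite: "unit_sphere_area TYPE('a::euclidean_space) \<noteq> \<infinity>"
  using emeasure_lborel_ball_finite[of "0::'a" 1]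
  by (simp add: unit_sphere_area_eq ennreal_mult_eq_top_iff)

section \<open>Lower bound for the modulus\<close>

lemma arc_length_ray:
  fixes u :: "'a::real_normed_vector"
  assumes u: "norm u = 1" and ab: "a \<le> b"
  shows "arc_length (\<lambda>t. t *\<^sub>R u) a b = ennreal (b - a)"
proof -
  have d: "dist (x *\<^sub>R u) (y *\<^sub>R u) = \<bar>x - y\<bar>" for x y :: real
    using u by (simp add: dist_norm flip: scaleR_diff_left)
  show ?thesis
  proof (rule antisym)
    show "arc_length (\<lambda>t. t *\<^sub>R u) a b \<le> ennreal (b - a)"
      unfolding arc_length_def
    proof (rule SUP_least)
      fix ts :: "real list" assume "ts \<in> {ts. sorted ts \<and> set ts \<subseteq> {a..b}}"
      then have ts: "sorted ts" "set ts \<subseteq> {a..b}" by auto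
      have "(\<Sum>i<length ts - 1. ennreal (dist (ts ! i *\<^sub>R u) (ts ! Suc i *\<^sub>R u)))
          = (\<Sum>i<length ts - 1. ennreal (ts ! Suc i - ts ! i))"
      proof (rule sum.cong[OF refl])
        fix i assume "i \<in> {..<length ts - 1}"
        then have "ts ! i \<le> ts ! Suc i" using ts by (intro sorted_nth_mono) auto
        then show "ennreal (dist (ts ! i *\<^sub>R u) (ts ! Suc i *\<^sub>R u)) = ennreal (ts ! Suc i - ts ! i)"
          using u by (simp add: d)
      qed
      also have "\<dots> = ennreal (\<Sum>i<length ts - 1. ts ! Suc i - ts ! i)"
        using ts by (intro sum_ennreal) (auto intro!: sorted_nth_mono)
      also have "(\<Sum>i<length ts - 1. ts ! Suc i - ts ! i) = ts ! (length ts - 1) - ts ! 0"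
        by (rule sum_lessThan_telescope)
      also have "ennreal (ts ! (length ts - 1) - ts ! 0) \<le> ennreal (b - a)"
      \<comment> \<open>For the empty list both indices are 0, so the difference is 0 whatever value
        \<open>ts ! 0\<close> has.\<close>
      proof (cases "ts = []")
        case False
        then have "ts ! (length ts - 1) \<in> {a..b}" "ts ! 0 \<in> {a..b}"
          using ts by (auto simp: subset_iff)
        then show ?thesis by (intro ennreal_leI) auto
      qed simp
      finally show "(\<Sum>i<length ts - 1. ennreal (dist (ts ! i *\<^sub>R u) (ts ! Suc i *\<^sub>R u))) \<le> ennreal (b - a)" .
    qed
    show "ennreal (b - a) \<le> arc_length (\<lambda>t. t *\<^sub>R u) a b"
      unfolding arc_length_def using ab u by (intro SUP_upper2[of "[a, b]"]) (auto simp: d)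
  qed
qed

lemma segment_integral_ray:
  fixes u :: "'a::euclidean_space"
  assumes u: "norm u = 1" and ab: "a \<le> b" and [measurable]: "\<rho> \<in> borel_measurable borel"
  shows "segment_integral \<rho> (\<lambda>t. t *\<^sub>R u) a b = (\<integral>\<^sup>+t\<in>{a..b}. \<rho> (t *\<^sub>R u) \<partial>lborel)"
proof -
  have param: "arc_length_param (\<lambda>t. t *\<^sub>R u) a b s = (a + s) *\<^sub>R u" if "s \<in> {0..b - a}" for s
  proof -
    \<comment> \<open>Arc length is strictly increasing along a ray, so the choice of the parameter
      is forced.\<close>
    have "(SOME t. t \<in> {a..b} \<and> arc_length (\<lambda>t. t *\<^sub>R u) a t = ennreal s) = a + s"
      using that u by (intro some_equality) (auto simp: arc_length_ray)
    then show ?thesis by (simp add: arc_length_param_def)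
  qed
  have "segment_integral \<rho> (\<lambda>t. t *\<^sub>R u) a b = (\<integral>\<^sup>+s\<in>{0..b - a}. \<rho> ((a + s) *\<^sub>R u) \<partial>lborel)"
    unfolding segment_integral_def using u ab
    by (intro nn_integral_cong) (auto simp: arc_length_ray param split: split_indicator)
  also have "\<dots> = (\<integral>\<^sup>+s. \<rho> ((a + s) *\<^sub>R u) * indicator {a..b} (a + s) \<partial>lborel)"
    by (intro nn_integral_cong) (auto simp: indicator_def)
  also have "\<dots> = (\<integral>\<^sup>+t\<in>{a..b}. \<rho> (t *\<^sub>R u) \<partial>lborel)"
  proof -
    have "(\<lambda>t. \<rho> (t *\<^sub>R u) * indicator {a..b} t) \<in> borel_measurable borel" by measurable
    from nn_integral_real_affine[OF this, of 1 a] show ?thesis by simp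
  qed
  finally show ?thesis .
qed

section \<open>A weighted integral inequality on an interval\<close>

lemma ennpowr_measurable [measurable]: "(\<lambda>x. ennpowr x p) \<in> borel_measurable borel"
  unfolding ennpowr_def by measurable

lemma nn_integral_powr_from_0:
  fixes e L :: real
  assumes "e > -1" "L > 0"
  shows "(\<integral>\<^sup>+s\<in>{0<..L}. ennreal (s powr e) \<partial>lborel) = ennreal (L powr (e + 1) / (e + 1))"
proof -
  have "(\<integral>\<^sup>+s\<in>{0<..L}. ennreal (s powr e) \<partial>lborel) = (\<integral>\<^sup>+s. ennreal (indicator {0..L} s * s powr e) \<partial>lborel)"
    by (rule nn_integral_cong_AE, use AE_lborel_singleton[of 0] in eventually_elim)
      (auto simp: indicator_def)
  also have "\<dots> = ennreal (L powr (e + 1) / (e + 1))"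
    using assms by (intro nn_integral_has_integral_lebesgue has_integral_powr_from_0) auto
  finally show ?thesis .
qed

text \<open>Instead of Hoelder's inequality, the tangent to \<open>x \<mapsto> x powr p\<close> at the point \<open>w s / W\<close> is used,
  where \<open>w s = s powr (- (n - 1) / (p - 1))\<close> is extremal and \<open>W\<close> is its integral.\<close>

lemma weighted_nn_integral_lower_bound:
  fixes h :: "real \<Rightarrow> ennreal" and p L :: real and n :: nat
  defines "\<delta> \<equiv> (p - real n) / (p - 1)"
  assumes [measurable]: "h \<in> borel_measurable borel"
    and n: "0 < n" "real n < p" and L: "L > 0"
    and h: "1 \<le> (\<integral>\<^sup>+s\<in>{0<..L}. h s \<partial>lborel)"
  shows "ennreal ((L powr \<delta> / \<delta>) powr (1 - p)) \<le> (\<integral>\<^sup>+s\<in>{0<..L}. ennreal (s ^ (n - 1)) * ennpowr (h s) p \<partial>lborel)"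
proof -
  define W where "W = L powr \<delta> / \<delta>"
  define \<beta> where "\<beta> = (real n - 1) / (p - 1)"
  have p: "p > 1" using n by linarith
  have \<delta>: "\<delta> > 0" "\<delta> = 1 - \<beta>" using n p by (auto simp: \<delta>_def \<beta>_def field_simps)
  have W: "W > 0" using \<delta> L by (simp add: W_def)
  let ?I = "\<integral>\<^sup>+s\<in>{0<..L}. ennreal (s ^ (n - 1)) * ennpowr (h s) p \<partial>lborel"
  have tangent: "p * W powr (1 - p) * x \<le> s ^ (n - 1) * x powr p + (p - 1) * W powr - p * s powr - \<beta>"
    if "s > 0" "x \<ge> 0" for s x :: real
  proof -
    define c where "c = s powr - \<beta> / W"
    have c: "c > 0" using that W by (simp add: c_def)
    \<comment> \<open>Young's inequality for \<open>x\<close> and \<open>c powr (p - 1)\<close> with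
      exponents \<open>p\<close> and \<open>p / (p - 1)\<close>; multiplied by \<open>p\<close>, it
      says that the graph of \<open>x powr p\<close> lies above its tangent at
      \<open>c\<close>.\<close>
    have "x * c powr (p - 1) \<le> x powr p / p + (c powr (p - 1)) powr (p / (p - 1)) / (p / (p - 1))"
      using p that by (intro Youngs_inequality) (auto simp: field_simps)
    then have "p * (x * c powr (p - 1)) \<le> p * (x powr p / p + c powr p / (p / (p - 1)))"
      using p c by (intro mult_left_mono) (auto simp: powr_powr)
    also have "\<dots> = x powr p + (p - 1) * c powr p"
      using p by (simp add: field_simps)
    finally have "p * c powr (p - 1) * x \<le> x powr p + (p - 1) * c powr p"
      by (simp add: mult_ac)
    then have *: "s ^ (n - 1) * (p * c powr (p - 1) * x) \<le> s ^ (n - 1) * (x powr p + (p - 1) * c powr p)"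
      using that by (intro mult_left_mono) auto
    have "\<beta> * (p - 1) = real (n - 1)" using p n by (simp add: \<beta>_def of_nat_diff)
    then have "s ^ (n - 1) = s powr (\<beta> * (p - 1))"
      using that by (simp add: powr_realpow)
    \<comment> \<open>Here the choice of \<open>\<beta>\<close> pays off: the weight cancels the
      power of \<open>s\<close> in the slope. The slope is then the same for all \<open>s\<close>,
      and integrating the linear term involves \<open>h\<close> through its plain integral
      alone.\<close>
    then have c1: "s ^ (n - 1) * c powr (p - 1) = W powr (1 - p)"
    proof -
      have "c powr (p - 1) = s powr - (\<beta> * (p - 1)) * W powr (1 - p)"
        using that W powr_minus_divide[of W "p - 1"] by (simp add: c_def powr_divide powr_powr)
      moreover have "s powr (\<beta> * (p - 1)) * s powr - (\<beta> * (p - 1)) = 1"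
        using that by (simp flip: powr_add)
      ultimately show ?thesis
        using \<open>s ^ (n - 1) = _\<close> by (simp only: mult_1_left flip: mult.assoc)
    qed
    have "c powr p = c powr (p - 1) * c" using c by (simp add: powr_diff)
    then have "s ^ (n - 1) * c powr p = W powr (1 - p) * c" by (simp only: c1 flip: mult.assoc)
    also have "\<dots> = W powr - p * s powr - \<beta>"
      using W by (simp add: c_def powr_diff powr_minus field_simps)
    finally have c2: "s ^ (n - 1) * c powr p = W powr - p * s powr - \<beta>" .
    have "s ^ (n - 1) * (p * c powr (p - 1) * x) = p * W powr (1 - p) * x"
      unfolding c1[symmetric] by (simp only: mult_ac)
    moreover have "s ^ (n - 1) * (x powr p + (p - 1) * c powr p)
        = s ^ (n - 1) * x powr p + (p - 1) * W powr - p * s powr - \<beta>"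
      using c2 by (simp add: algebra_simps)
    ultimately show ?thesis using * by (simp only:)
  qed
  have tangent': "ennreal (p * W powr (1 - p)) * h s \<le> ennreal (s ^ (n - 1)) * ennpowr (h s) p
      + ennreal ((p - 1) * W powr - p) * ennreal (s powr - \<beta>)" if "s > 0" for s
  proof (cases "h s")
    case (real x)
    have "ennreal (p * W powr (1 - p)) * h s = ennreal (p * W powr (1 - p) * x)"
      using real p by (simp add: ennreal_mult)
    also have "\<dots> \<le> ennreal (s ^ (n - 1) * x powr p + (p - 1) * W powr - p * s powr - \<beta>)"
      using tangent[OF that] real by (intro ennreal_leI) auto
    also have "\<dots> = ennreal (s ^ (n - 1)) * ennpowr (h s) p
      + ennreal ((p - 1) * W powr - p) * ennreal (s powr - \<beta>)"
      using p real that by (simp add: ennpowr_def ennreal_mult)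
    finally show ?thesis .
  next
    case top
    then show ?thesis using that by (simp add: ennpowr_def ennreal_mult_top)
  qed
  \<comment> \<open>The split \<open>p = 1 + (p - 1)\<close> separates the desired bound from a term
    equal to the integrated constant part of the tangent, the integral of
    \<open>s powr - \<beta>\<close> being \<open>W\<close>. That finite term is cancelled at the
    end.\<close>
  have "ennreal (W powr (1 - p)) + ennreal ((p - 1) * W powr (1 - p)) = ennreal (p * W powr (1 - p)) * 1"
  proof -
    have "W powr (1 - p) + (p - 1) * W powr (1 - p) = p * W powr (1 - p)" by (simp add: algebra_simps)
    then show ?thesis using p by (simp flip: ennreal_plus)
  qed
  also have "\<dots> \<le> ennreal (p * W powr (1 - p)) * (\<integral>\<^sup>+s\<in>{0<..L}. h s \<partial>lborel)"
    using h by (rule mult_left_mono) simp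
  also have "\<dots> = (\<integral>\<^sup>+s. ennreal (p * W powr (1 - p)) * (h s * indicator {0<..L} s) \<partial>lborel)"
    by (rule nn_integral_cmult[symmetric]) measurable
  also have "\<dots> \<le> (\<integral>\<^sup>+s. ennreal (s ^ (n - 1)) * ennpowr (h s) p * indicator {0<..L} s
      + ennreal ((p - 1) * W powr - p) * (ennreal (s powr - \<beta>) * indicator {0<..L} s) \<partial>lborel)"
    using tangent' by (intro nn_integral_mono) (auto simp: indicator_def)
  also have "\<dots> = ?I + ennreal ((p - 1) * W powr - p) * (\<integral>\<^sup>+s\<in>{0<..L}. ennreal (s powr - \<beta>) \<partial>lborel)"
    by (simp add: nn_integral_add nn_integral_cmult)
  also have "(\<integral>\<^sup>+s\<in>{0<..L}. ennreal (s powr - \<beta>) \<partial>lborel) = ennreal W"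
    using \<delta> L by (subst nn_integral_powr_from_0) (auto simp: W_def)
  also have "ennreal ((p - 1) * W powr - p) * ennreal W = ennreal ((p - 1) * W powr (1 - p))"
    using p W by (simp add: powr_diff powr_minus field_simps flip: ennreal_mult)
  finally show ?thesis
    by (simp add: ennreal_add_left_cancel_le add.commute W_def)
qed

text \<open>An admissible density has integral at least 1 over \<open>{0<..L}\<close> on every ray,
  so the weighted inequality holds in each direction and can be integrated over all of them. The
  starting point \<open>a\<close> may vary with \<open>u\<close> without any lower bound. Since
  \<open>\<delta> * (1 - p) = DIM('a) - p\<close>, the result is a multiple of L^(n - p).\<close>

lemma modulus_ge_of_radial_segments:
  fixes \<Gamma> :: "'a::euclidean_space curve set" and p L :: real
  defines "\<delta> \<equiv> (p - real DIM('a)) / (p - 1)"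
  assumes p: "real DIM('a) < p" and L: "L > 0"
    and rays: "\<And>u. norm u = 1 \<Longrightarrow> \<exists>a b. 0 < a \<and> a < b \<and> b \<le> L \<and> ({a..b}, \<lambda>t. t *\<^sub>R u) \<in> \<Gamma>"
  shows "unit_sphere_area TYPE('a) * ennreal ((L powr \<delta> / \<delta>) powr (1 - p)) \<le> modulus p \<Gamma>"
  unfolding modulus_def
proof (rule INF_greatest)
  fix \<rho> assume "\<rho> \<in> admissible \<Gamma>"
  then have [measurable]: "\<rho> \<in> borel_measurable borel"
    and adm: "\<And>c. c \<in> \<Gamma> \<Longrightarrow> locally_rectifiable c \<Longrightarrow> 1 \<le> line_integral \<rho> c"
    by (auto simp: admissible_def)
  let ?c = "ennreal ((L powr \<delta> / \<delta>) powr (1 - p))"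
  have ray: "?c \<le> (\<integral>\<^sup>+t\<in>{0<..}. ennreal (t ^ (DIM('a) - 1)) * ennpowr (\<rho> (t *\<^sub>R u)) p \<partial>lborel)"
    if u: "norm u = 1" for u :: 'a
  proof -
    obtain a b where ab: "0 < a" "a < b" "b \<le> L" and c: "({a..b}, \<lambda>t. t *\<^sub>R u) \<in> \<Gamma>"
      using rays[OF u] by blast
    have "locally_rectifiable ({a..b}, \<lambda>t. t *\<^sub>R u)"
      using u by (auto simp: locally_rectifiable_def arc_length_ray)
    then have "1 \<le> line_integral \<rho> ({a..b}, \<lambda>t. t *\<^sub>R u)"
      by (rule adm[OF c])
    also have "\<dots> \<le> (\<integral>\<^sup>+s\<in>{0<..L}. \<rho> (s *\<^sub>R u) \<partial>lborel)"
      unfolding line_integral_def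
    proof (rule SUP_least, clarify)
      fix a' b' :: real assume "a' \<le> b'" "{a'..b'} \<subseteq> fst ({a..b}, \<lambda>t. t *\<^sub>R u)"
      moreover from this ab have "{a'..b'} \<subseteq> {0<..L}" by auto
      ultimately show "segment_integral \<rho> (snd ({a..b}, \<lambda>t. t *\<^sub>R u)) a' b'
          \<le> (\<integral>\<^sup>+s\<in>{0<..L}. \<rho> (s *\<^sub>R u) \<partial>lborel)"
        using u by (auto intro!: nn_integral_mono simp: segment_integral_ray indicator_def)
    qed
    finally have "?c \<le> (\<integral>\<^sup>+t\<in>{0<..L}. ennreal (t ^ (DIM('a) - 1)) * ennpowr (\<rho> (t *\<^sub>R u)) p \<partial>lborel)"
      unfolding \<delta>_def using p L by (intro weighted_nn_integral_lower_bound) auto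
    also have "\<dots> \<le> (\<integral>\<^sup>+t\<in>{0<..}. ennreal (t ^ (DIM('a) - 1)) * ennpowr (\<rho> (t *\<^sub>R u)) p \<partial>lborel)"
      by (intro nn_integral_mono) (auto simp: indicator_def)
    finally show ?thesis .
  qed
  \<comment> \<open>The ball serves as the set of directions: \<open>x\<close> stands for the unit
    vector \<open>x /\<^sub>R norm x\<close>, and \<open>DIM('a)\<close> times the volume of the
    ball is the area of the unit sphere.\<close>
  have "unit_sphere_area TYPE('a) * ?c = (\<integral>\<^sup>+x\<in>ball (0::'a) 1. ennreal (real DIM('a)) * ?c \<partial>lborel)"
    by (subst nn_integral_cmult_indicator) (auto simp: unit_sphere_area_eq mult_ac)
  also have "\<dots> \<le> (\<integral>\<^sup>+x\<in>ball 0 1. (\<integral>\<^sup>+t\<in>{0<..}. ennreal (real DIM('a) * t ^ (DIM('a) - 1)) *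
      ennpowr (\<rho> ((t / norm x) *\<^sub>R x)) p \<partial>lborel) \<partial>lborel)"
  proof (rule nn_integral_mono_AE, use AE_lborel_singleton[of 0] in eventually_elim)
    fix x :: 'a assume "x \<noteq> 0"
    then have "norm (x /\<^sub>R norm x) = 1" by simp
    from mult_left_mono[OF ray[OF this], of "ennreal (real DIM('a))"]
    have "ennreal (real DIM('a)) * ?c \<le> ennreal (real DIM('a)) * (\<integral>\<^sup>+t\<in>{0<..}. ennreal (t ^ (DIM('a) - 1)) *
        ennpowr (\<rho> ((t / norm x) *\<^sub>R x)) p \<partial>lborel)"
      by (simp add: divide_inverse)
    also have "\<dots> = (\<integral>\<^sup>+t\<in>{0<..}. ennreal (real DIM('a) * t ^ (DIM('a) - 1)) *
        ennpowr (\<rho> ((t / norm x) *\<^sub>R x)) p \<partial>lborel)"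
      by (subst nn_integral_cmult[symmetric])
        (auto intro!: nn_integral_cong simp: indicator_def ennreal_mult mult.assoc)
    finally show "ennreal (real DIM('a)) * ?c * indicator (ball 0 1) x \<le> (\<integral>\<^sup>+t\<in>{0<..}. ennreal (real DIM('a) * t ^ (DIM('a) - 1)) *
        ennpowr (\<rho> ((t / norm x) *\<^sub>R x)) p \<partial>lborel) * indicator (ball 0 1) x"
      by (rule mult_right_mono) simp
  qed
  also have "\<dots> = (\<integral>\<^sup>+x. ennpowr (\<rho> x) p \<partial>lebesgue)"
    unfolding nn_integral_completion by (rule nn_integral_polar[symmetric]) measurable
  finally show "unit_sphere_area TYPE('a) * ?c \<le> (\<integral>\<^sup>+x. ennpowr (\<rho> x) p \<partial>lebesgue)" .
qed

text \<open>A ray may cross the image of the outer sphere many times, so \<open>b\<close> is taken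
  as its first exit from the image \<open>U\<close> of the ball. The intermediate value theorem for
  the norm of the preimage, which runs from 0 to \<open>r2\<close> along the ray, then yields
  \<open>a\<close>.\<close>

lemma radial_segment_in_joining_curves:
  fixes f :: "'a::euclidean_space \<Rightarrow> 'a"
  assumes hom: "homeomorphism (ball 0 1) (f ` ball 0 1) f g" and f0: "f 0 = 0"
    and r: "0 < r1" "r1 < r2" "r2 < 1"
    and L: "\<And>x. x \<in> sphere 0 r2 \<Longrightarrow> norm (f x) \<le> L"
    and u: "norm u = 1"
  shows "\<exists>a b. 0 < a \<and> a < b \<and> b \<le> L \<and>
    ({a..b}, \<lambda>t. t *\<^sub>R u) \<in> \<Delta> (f ` sphere 0 r1) (f ` sphere 0 r2) (f ` ball 0 1)"
proof -
  define U where "U = f ` ball 0 r2"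
  have gf: "\<And>x. x \<in> ball 0 1 \<Longrightarrow> g (f x) = x" and cf: "continuous_on (ball 0 1) f"
    and cg: "continuous_on (f ` ball 0 1) g"
    using hom by (auto simp: homeomorphism_def)
  have sub: "cball (0::'a) r2 \<subseteq> ball 0 1" "ball (0::'a) r2 \<subseteq> ball 0 1" using r by auto
  have inj: "inj_on f (ball 0 1)" using gf by (metis inj_on_inverseI)
  have "compact (f ` cball 0 r2)"
    using cf sub by (intro compact_continuous_image) (auto intro: continuous_on_subset)
  have UK: "U \<subseteq> f ` cball 0 r2" unfolding U_def by (rule image_mono) auto
  have "open U" unfolding U_def
    using cf inj sub(2) by (intro invariance_of_domain) (auto intro: continuous_on_subset inj_on_subset)
  have "bounded U" using \<open>compact (f ` cball 0 r2)\<close> UK by (meson bounded_subset compact_imp_bounded)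
  have "closure U \<subseteq> f ` cball 0 r2"
    using UK \<open>compact (f ` cball 0 r2)\<close> by (simp add: closure_minimal compact_imp_closed)
  \<comment> \<open>By invariance of domain \<open>U\<close> is open, so its frontier is its closure
    without \<open>U\<close>. What then remains of the image of the closed ball comes from the
    sphere.\<close>
  then have frontier: "frontier U \<subseteq> f ` sphere 0 r2"
    using \<open>open U\<close> by (fastforce simp: frontier_def interior_open U_def image_iff)
  have "0 \<in> U" using f0 r by (auto simp: U_def intro!: image_eqI[of _ _ 0])
  then have "0 \<in> interior U" using \<open>open U\<close> by (simp add: interior_open)
  moreover have "u \<noteq> 0" using u by auto
  ultimately obtain b where b: "0 < b" "b *\<^sub>R u \<in> frontier U"
      and inU: "\<And>e. 0 \<le> e \<Longrightarrow> e < b \<Longrightarrow> e *\<^sub>R u \<in> U"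
    using ray_to_frontier[OF \<open>bounded U\<close>, of 0 u] \<open>open U\<close> by (auto simp: interior_open)
  obtain y where y: "y \<in> sphere 0 r2" "b *\<^sub>R u = f y" using b frontier by auto
  have UD: "U \<subseteq> f ` ball 0 1" unfolding U_def using sub by blast
  have yD: "y \<in> ball 0 1" using y r by auto
  \<comment> \<open>The endpoint \<open>b\<close> is included: it lies outside \<open>U\<close>, but
    its preimage has norm \<open>r2 < 1\<close>. Hence \<open>g\<close> is continuous along the
    whole closed segment.\<close>
  have inD: "t *\<^sub>R u \<in> f ` ball 0 1" if "0 \<le> t" "t \<le> b" for t
    using inU[of t] that UD y yD by (cases "t = b") auto
  have "norm (b *\<^sub>R u) \<le> L" using y L by metis
  then have "b \<le> L" using u b by simp
  let ?h = "\<lambda>t. norm (g (t *\<^sub>R u))"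
  have "continuous_on {0..b} ?h"
    using inD by (intro continuous_on_norm continuous_on_compose2[OF cg] continuous_intros) auto
  moreover have h0: "?h 0 = 0" using gf[of 0] f0 by simp
  moreover have hb: "?h b = r2" using gf[OF yD] y by simp
  ultimately obtain a where a: "0 \<le> a" "a \<le> b" "?h a = r1"
    using IVT'[of ?h 0 r1 b] r b by auto
  have "0 < a" using a h0 r by (cases "a = 0") auto
  moreover have "a < b" using a hb r by (cases "a = b") auto
  moreover have "a *\<^sub>R u \<in> f ` sphere 0 r1"
  proof -
    obtain x where "x \<in> ball 0 1" "a *\<^sub>R u = f x" using inD[OF a(1,2)] by auto
    then show ?thesis using a gf by auto
  qed
  moreover have "is_curve ({a..b}, \<lambda>t. t *\<^sub>R u)"
    using a by (auto simp: is_curve_def is_interval_cc intro!: continuous_intros)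
  ultimately show ?thesis
    using \<open>b \<le> L\<close> y inD by (intro exI[of _ a] exI[of _ b]) (auto simp: joining_curves_def)
qed

section \<open>Upper bound for the modulus\<close>

lemma nn_integral_powr_Ioo:
  fixes c r1 r2 :: real
  assumes "0 < c" "0 < r1" "r1 < r2"
  shows "(\<integral>\<^sup>+t\<in>{r1<..<r2}. ennreal (t powr (c - 1)) \<partial>lborel) = ennreal ((r2 powr c - r1 powr c) / c)"
proof -
  have "(\<integral>\<^sup>+t\<in>{r1<..<r2}. ennreal (t powr (c - 1)) \<partial>lborel)
      = (\<integral>\<^sup>+t. ennreal (t powr (c - 1)) * indicator {r1..r2} t \<partial>lborel)"
    by (rule nn_integral_cong_AE, use AE_lborel_singleton[of r1] AE_lborel_singleton[of r2] in eventually_elim)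
      (auto simp: indicator_def)
  also have "\<dots> = ennreal (r2 powr c / c - r1 powr c / c)"
    using assms by (intro nn_integral_FTC_Icc) (auto intro!: derivative_eq_intros)
  finally show ?thesis by (simp add: diff_divide_distrib)
qed

text \<open>The function \<open>Q\<close> is only Lebesgue measurable, so its integral over a given sphere need not be
  additive; it is replaced by a Borel function, which changes it on almost no sphere.\<close>

lemma nn_integral_ring_le:
  fixes Q :: "'a::euclidean_space \<Rightarrow> ennreal" and \<phi> \<psi> :: "real \<Rightarrow> ennreal"
  assumes Q: "Q \<in> borel_measurable (lebesgue_on (ball 0 1))"
    and r: "0 < r1" "r2 \<le> 1"
    and [measurable]: "\<phi> \<in> borel_measurable borel" "\<psi> \<in> borel_measurable borel"
    and bound: "AE t in lborel. t \<in> {r1<..<r2} \<longrightarrow> (\<integral>\<^sup>+x\<in>sphere 0 t. Q x \<partial>sphere_area 0 t) \<le> \<psi> t"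
  shows "(\<integral>\<^sup>+x\<in>spherical_ring 0 r1 r2. Q x * \<phi> (norm x) \<partial>lebesgue) \<le> (\<integral>\<^sup>+t\<in>{r1<..<r2}. \<psi> t * \<phi> t \<partial>lborel)"
proof -
  have "(\<lambda>x. if x \<in> ball 0 1 then Q x else 0) \<in> borel_measurable lebesgue"
    using Q by (subst measurable_restrict_space_iff[symmetric]) auto
  from completion_ex_borel_measurable[OF this] obtain Q' :: "'a \<Rightarrow> ennreal" where
    Q'[measurable]: "Q' \<in> borel_measurable borel"
    and eq: "AE x in lborel. (if x \<in> ball 0 1 then Q x else 0) = Q' x" by auto
  let ?g = "\<lambda>x. Q' x * \<phi> (norm x) * indicator {r1<..<r2} (norm x)"
  have "(\<integral>\<^sup>+x\<in>spherical_ring 0 r1 r2. Q x * \<phi> (norm x) \<partial>lebesgue) = (\<integral>\<^sup>+x. ?g x \<partial>lborel)"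
    unfolding nn_integral_completion
  proof (rule nn_integral_cong_AE, use eq in eventually_elim)
    fix x assume "(if x \<in> ball 0 1 then Q x else 0) = Q' x"
    then show "Q x * \<phi> (norm x) * indicator (spherical_ring 0 r1 r2) x = ?g x"
      using r by (auto simp: spherical_ring_def indicator_def split: if_splits)
  qed
  also have "\<dots> = (\<integral>\<^sup>+t\<in>{0<..}. (\<integral>\<^sup>+x. ?g x \<partial>sphere_area 0 t) \<partial>lborel)"
    by (rule nn_integral_spheres) measurable
  also have "\<dots> \<le> (\<integral>\<^sup>+t\<in>{r1<..<r2}. \<psi> t * \<phi> t \<partial>lborel)"
  proof (rule nn_integral_mono_AE, use bound AE_sphere_area[OF eq] in eventually_elim)
    fix t :: real
    assume t: "t \<in> {r1<..<r2} \<longrightarrow> (\<integral>\<^sup>+x\<in>sphere 0 t. Q x \<partial>sphere_area 0 t) \<le> \<psi> t"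
      and eq_t: "0 < t \<longrightarrow> (AE x in sphere_area 0 t. (if x \<in> ball 0 1 then Q x else 0) = Q' x)"
    show "(\<integral>\<^sup>+x. ?g x \<partial>sphere_area 0 t) * indicator {0<..} t \<le> \<psi> t * \<phi> t * indicator {r1<..<r2} t"
    proof (cases "0 < t")
      case True
      have "(\<integral>\<^sup>+x. ?g x \<partial>sphere_area 0 t)
          = (\<integral>\<^sup>+x. Q' x * (\<phi> t * indicator {r1<..<r2} t) \<partial>sphere_area 0 t)"
        by (rule nn_integral_cong_AE, use AE_sphere_area_in_sphere[OF True] in eventually_elim)
          (auto simp: mult_ac)
      also have "\<dots> = (\<integral>\<^sup>+x. Q' x \<partial>sphere_area 0 t) * (\<phi> t * indicator {r1<..<r2} t)"
      proof (rule nn_integral_multc)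
        show "Q' \<in> borel_measurable (sphere_area 0 t)"
          unfolding sphere_area_def by (rule measurable_completion) simp
      qed
      also have "\<dots> \<le> \<psi> t * \<phi> t * indicator {r1<..<r2} t"
      proof (cases "t \<in> {r1<..<r2}")
        \<comment> \<open>As \<open>r2 \<le> 1\<close>, the sphere lies in the unit ball, where
          \<open>Q\<close> and \<open>Q'\<close> agree area-almost everywhere for the radii
          considered.\<close>
        case in_ring: True
        have "(\<integral>\<^sup>+x. Q' x \<partial>sphere_area 0 t) \<le> (\<integral>\<^sup>+x\<in>sphere 0 t. Q x \<partial>sphere_area 0 t)"
          by (rule nn_integral_mono_AE,
              use AE_sphere_area_in_sphere[OF True] eq_t[rule_format, OF True] in eventually_elim)
            (use in_ring r in \<open>auto split: if_splits\<close>)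
        also have "\<dots> \<le> \<psi> t" using t in_ring by blast
        finally show ?thesis using in_ring by (simp add: mult_right_mono)
      qed simp
      finally show ?thesis using True by simp
    qed simp
  qed
  finally show ?thesis .
qed

lemma boundary_dist_ball: "1 \<le> boundary_dist (0::'a::euclidean_space) (ball 0 1)"
  unfolding boundary_dist_def by (rule INF_greatest) (simp add: frontier_ball)

text \<open>Minimising the integral of t^(n - 1 - alpha) * eta^p under the constraint that eta has
  integral 1 makes t^(n - 1 - alpha) * eta^(p - 1) constant. This gives a multiple of
  \<open>t powr (\<gamma> - 1)\<close>, and \<open>I\<close> is the normalising integral.\<close>

lemma ring_Q_modulus_upper_bound:
  fixes p q\<^sub>0 \<alpha> \<epsilon>\<^sub>0 r1 r2 :: real
    and Q :: "'a::euclidean_space \<Rightarrow> ennreal"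
    and f :: "'a \<Rightarrow> 'a"
  defines "\<gamma> \<equiv> (\<alpha> + p - real DIM('a)) / (p - 1)"
  assumes p: "real DIM('a) < p"
    and Q: "Q \<in> borel_measurable (lebesgue_on (ball 0 1))"
    and f: "ring_Q_homeomorphism p (ball 0 1) Q 0 f"
    and q: "0 < q\<^sub>0" and \<alpha>: "0 \<le> \<alpha>"
    and mean: "AE t in lebesgue. t \<in> {0<..<\<epsilon>\<^sub>0} \<longrightarrow>
           sphere_mean Q 0 t \<le> ennreal (q\<^sub>0 * t powr (- \<alpha>))"
    and r: "0 < r1" "r1 < r2" "r2 < \<epsilon>\<^sub>0" "r2 < 1"
  shows "modulus p (\<Delta> (f ` sphere 0 r1) (f ` sphere 0 r2) (f ` ball 0 1)) \<le>
    unit_sphere_area TYPE('a) * ennreal (q\<^sub>0 * ((r2 powr \<gamma> - r1 powr \<gamma>) / \<gamma>) powr (1 - p))"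
proof -
  let ?n = "DIM('a)" and ?\<omega> = "unit_sphere_area TYPE('a)"
  define I where "I = (r2 powr \<gamma> - r1 powr \<gamma>) / \<gamma>"
  have n: "0 < ?n" by simp
  have p1: "p > 1" using p n by linarith
  have \<gamma>: "\<gamma> > 0" using p p1 \<alpha> by (simp add: \<gamma>_def)
  have I: "I > 0" using r \<gamma> by (simp add: I_def powr_less_mono2)
  define \<eta> where "\<eta> t = ennreal (t powr (\<gamma> - 1) / I)" for t
  have [measurable]: "\<eta> \<in> borel_measurable borel"
    unfolding \<eta>_def[abs_def] by measurable
  have \<eta>_int: "(\<integral>\<^sup>+t\<in>{r1<..<r2}. \<eta> t \<partial>lebesgue) = 1"
  proof -
    have "(\<integral>\<^sup>+t\<in>{r1<..<r2}. \<eta> t \<partial>lebesgue) = (\<integral>\<^sup>+t. ennreal (1 / I) * (ennreal (t powr (\<gamma> - 1)) * indicator {r1<..<r2} t) \<partial>lborel)"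
      unfolding nn_integral_completion \<eta>_def using I
      by (intro nn_integral_cong) (simp flip: ennreal_mult' mult.assoc)
    also have "\<dots> = ennreal (1 / I) * ennreal I"
      using \<gamma> r by (subst nn_integral_cmult) (auto simp: nn_integral_powr_Ioo I_def)
    also have "\<dots> = 1" using I by (simp flip: ennreal_mult)
    finally show ?thesis .
  qed
  have "\<eta> \<in> borel_measurable (lebesgue_on {r1<..<r2})"
    by (intro measurable_restrict_space1 measurable_completion) simp
  moreover have "ereal r2 < boundary_dist (0::'a) (ball 0 1)"
    using less_le_trans[OF _ boundary_dist_ball, of "ereal r2"] r by (simp add: one_ereal_def)
  ultimately have "modulus p (\<Delta> (f ` sphere 0 r1) (f ` sphere 0 r2) (f ` ball 0 1))
      \<le> (\<integral>\<^sup>+x\<in>spherical_ring 0 r1 r2. Q x * ennpowr (\<eta> (norm x)) p \<partial>lebesgue)"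
    using f r \<eta>_int by (auto simp: ring_Q_homeomorphism_def)
  also have "\<dots> \<le> (\<integral>\<^sup>+t\<in>{r1<..<r2}. (?\<omega> * ennreal (q\<^sub>0 * t powr - \<alpha> * t ^ (?n - 1))) * ennpowr (\<eta> t) p \<partial>lborel)"
  proof (rule nn_integral_ring_le[OF Q])
    show "AE t in lborel. t \<in> {r1<..<r2} \<longrightarrow>
      (\<integral>\<^sup>+x\<in>sphere 0 t. Q x \<partial>sphere_area 0 t) \<le> ?\<omega> * ennreal (q\<^sub>0 * t powr - \<alpha> * t ^ (?n - 1))"
    proof (use mean[unfolded AE_completion_iff] in eventually_elim, intro impI)
      fix t assume m: "t \<in> {0<..<\<epsilon>\<^sub>0} \<longrightarrow> sphere_mean Q 0 t \<le> ennreal (q\<^sub>0 * t powr - \<alpha>)"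
        and t: "t \<in> {r1<..<r2}"
      let ?A = "\<integral>\<^sup>+x\<in>sphere 0 t. Q x \<partial>sphere_area 0 t" and ?B = "?\<omega> * ennreal (t ^ (?n - 1))"
      \<comment> \<open>In [0,\<infinity>] a bound for the mean gives one for the integral after
        multiplication by the divisor, provided that this is neither 0 nor infinite.\<close>
      have B: "?B \<noteq> 0" "?B \<noteq> top"
        using t r unit_sphere_area_nonzero[where 'a = 'a] unit_sphere_area_finite[where 'a = 'a]
        by (auto simp: ennreal_mult_eq_top_iff)
      have "?B / ?B = 1" using B by (intro ennreal_divide_self) (auto simp: less_top)
      then have "?A = ?A / ?B * ?B" by (simp only: ennreal_divide_times mult_1_right)
      also have "\<dots> \<le> ennreal (q\<^sub>0 * t powr - \<alpha>) * ?B"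
        using m t r by (intro mult_right_mono) (auto simp: sphere_mean_def)
      also have "\<dots> = ?\<omega> * ennreal (q\<^sub>0 * t powr - \<alpha> * t ^ (?n - 1))"
        using t r q by (simp add: ennreal_mult mult_ac)
      finally show "?A \<le> ?\<omega> * ennreal (q\<^sub>0 * t powr - \<alpha> * t ^ (?n - 1))" .
    qed
  qed (use r in auto)
  also have "\<dots> = (\<integral>\<^sup>+t. ?\<omega> * ennreal (q\<^sub>0 * I powr - p) * (ennreal (t powr (\<gamma> - 1)) * indicator {r1<..<r2} t) \<partial>lborel)"
  proof (rule nn_integral_cong)
    fix t :: real
    show "(?\<omega> * ennreal (q\<^sub>0 * t powr - \<alpha> * t ^ (?n - 1))) * ennpowr (\<eta> t) p * indicator {r1<..<r2} t
      = ?\<omega> * ennreal (q\<^sub>0 * I powr - p) * (ennreal (t powr (\<gamma> - 1)) * indicator {r1<..<r2} t)"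
    proof (cases "t \<in> {r1<..<r2}")
      case True
      then have t: "t > 0" using r by auto
      \<comment> \<open>By the choice of \<open>\<gamma>\<close>, the weight times the
        \<open>p\<close>-th power of the density is again a multiple of the density. The remaining
        integral is therefore \<open>I\<close> once more.\<close>
      have "\<gamma> * (p - 1) = \<alpha> + p - ?n" using p1 by (simp add: \<gamma>_def)
      then have e: "- \<alpha> + (real (?n - 1) + (\<gamma> - 1) * p) = \<gamma> - 1"
        using n by (simp add: of_nat_diff algebra_simps)
      have "t powr - \<alpha> * t ^ (?n - 1) * (t powr (\<gamma> - 1) / I) powr p
          = t powr - \<alpha> * (t powr real (?n - 1) * t powr ((\<gamma> - 1) * p)) * I powr - p"
      proof -
        have "(t powr (\<gamma> - 1) / I) powr p = t powr ((\<gamma> - 1) * p) * I powr - p"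
          using t I powr_minus_divide[of I p] by (simp add: powr_divide powr_powr)
        then show ?thesis using t by (simp only: powr_realpow mult.assoc)
      qed
      also have "\<dots> = t powr (\<gamma> - 1) * I powr - p"
        by (simp only: e flip: powr_add)
      finally have "q\<^sub>0 * t powr - \<alpha> * t ^ (?n - 1) * (t powr (\<gamma> - 1) / I) powr p
          = q\<^sub>0 * I powr - p * t powr (\<gamma> - 1)" by (simp add: mult_ac)
      then have "ennreal (q\<^sub>0 * t powr - \<alpha> * t ^ (?n - 1)) * ennpowr (\<eta> t) p
          = ennreal (q\<^sub>0 * I powr - p) * ennreal (t powr (\<gamma> - 1))"
        using q t I by (simp add: \<eta>_def ennpowr_def flip: ennreal_mult)
      then show ?thesis using True by (simp add: mult.assoc)
    qed simp
  qed
  also have "\<dots> = ?\<omega> * ennreal (q\<^sub>0 * I powr - p) * ennreal I"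
    using \<gamma> r by (subst nn_integral_cmult) (auto simp: nn_integral_powr_Ioo I_def)
  also have "\<dots> = ?\<omega> * ennreal (q\<^sub>0 * I powr (1 - p))"
    using I q by (simp add: mult.assoc powr_diff powr_minus divide_inverse mult_ac flip: ennreal_mult)
  finally show ?thesis by (simp add: I_def)
qed

section \<open>Growth of the maximum modulus\<close>

text \<open>This is stronger than a statement about an upper limit: the bound is attained on every
  sphere of small radius, at a point \<open>z\<close> where \<open>norm (f x)\<close> is
  maximal.\<close>

lemma ring_Q_max_norm_lower_bound:
  fixes p q\<^sub>0 \<alpha> \<epsilon>\<^sub>0 r :: real
    and Q :: "'a::euclidean_space \<Rightarrow> ennreal"
    and f :: "'a \<Rightarrow> 'a"
  assumes p: "real DIM('a) < p"
    and Q: "Q \<in> borel_measurable (lebesgue_on (ball 0 1))"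
    and f: "ring_Q_homeomorphism p (ball 0 1) Q 0 f" and f0: "f 0 = 0"
    and q: "0 < q\<^sub>0" and \<alpha>: "0 \<le> \<alpha>"
    and mean: "AE t in lebesgue. t \<in> {0<..<\<epsilon>\<^sub>0} \<longrightarrow>
           sphere_mean Q 0 t \<le> ennreal (q\<^sub>0 * t powr (- \<alpha>))"
    and r: "0 < r" "r < \<epsilon>\<^sub>0" "r < 1"
  shows "\<exists>z. norm z = r \<and> ((p - real DIM('a)) / (\<alpha> + p - real DIM('a))) powr ((p - 1) / (p - real DIM('a)))
      * q\<^sub>0 powr (1 / (real DIM('a) - p)) * r powr ((\<alpha> + p - real DIM('a)) / (p - real DIM('a))) \<le> norm (f z)"
proof -
  let ?n = "real DIM('a)" and ?\<omega> = "unit_sphere_area TYPE('a)"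
  define \<gamma> where "\<gamma> = (\<alpha> + p - ?n) / (p - 1)"
  define \<delta> where "\<delta> = (p - ?n) / (p - 1)"
  have p1: "p > 1" using p DIM_positive[where 'a = 'a] by linarith
  have \<gamma>: "\<gamma> > 0" and \<delta>: "\<delta> > 0" using p p1 \<alpha> by (auto simp: \<gamma>_def \<delta>_def)
  obtain g where hom: "homeomorphism (ball 0 1) (f ` ball 0 1) f g"
    using f by (auto simp: ring_Q_homeomorphism_def)
  have sub: "sphere (0::'a) r \<subseteq> ball 0 1" using r by auto
  have "continuous_on (sphere 0 r) (\<lambda>x. norm (f x))"
    using hom sub by (auto simp: homeomorphism_def intro!: continuous_intros intro: continuous_on_subset)
  moreover have "sphere (0::'a) r \<noteq> {}" using r by simp
  ultimately obtain z where z: "z \<in> sphere 0 r" and max: "\<And>x. x \<in> sphere 0 r \<Longrightarrow> norm (f x) \<le> norm (f z)"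
    using continuous_attains_sup[OF compact_sphere] by metis
  have zr: "norm z = r" using z by simp
  define L where "L = norm (f z)"
  have "f z \<noteq> 0"
  proof
    assume "f z = 0"
    then have "z = 0" using hom f0 sub z by (metis centre_in_ball homeomorphism_apply1 subsetD zero_less_one)
    then show False using zr r by simp
  qed
  then have L: "L > 0" by (simp add: L_def)
  define W where "W = L powr \<delta> / \<delta>"
  have W: "W > 0" using L \<delta> by (simp add: W_def)
  have le: "q\<^sub>0 powr (- 1 / (p - 1)) * ((r powr \<gamma> - s powr \<gamma>) / \<gamma>) \<le> W" if s: "0 < s" "s < r" for s
  proof -
    define I where "I = (r powr \<gamma> - s powr \<gamma>) / \<gamma>"
    have I: "I > 0" using s \<gamma> by (simp add: I_def powr_less_mono2)
    have "?\<omega> * ennreal (W powr (1 - p)) \<le> modulus p (\<Delta> (f ` sphere 0 s) (f ` sphere 0 r) (f ` ball 0 1))"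
      unfolding W_def \<delta>_def using p L s r max
      by (intro modulus_ge_of_radial_segments radial_segment_in_joining_curves[OF hom f0]) (auto simp: L_def)
    also have "\<dots> \<le> ?\<omega> * ennreal (q\<^sub>0 * I powr (1 - p))"
      unfolding I_def \<gamma>_def using s r by (intro ring_Q_modulus_upper_bound[OF p Q f q \<alpha> mean]) auto
    finally have "W powr (1 - p) \<le> q\<^sub>0 * I powr (1 - p)"
      using unit_sphere_area_nonzero[where 'a = 'a] unit_sphere_area_finite[where 'a = 'a] q
      by (simp add: ennreal_mult_le_mult_iff)
    also have "\<dots> = (q\<^sub>0 powr (- 1 / (p - 1)) * I) powr (1 - p)"
    proof -
      have "- 1 / (p - 1) * (1 - p) = 1" using p1 by (simp add: field_simps)
      then show ?thesis using q by (simp only: powr_mult powr_powr powr_one)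
    qed
    finally have "(W powr (1 - p)) \<le> (q\<^sub>0 powr (- 1 / (p - 1)) * I) powr (1 - p)" .
    \<comment> \<open>The exponent \<open>1 - p\<close> is negative, so comparing the powers
      reverses the inequality between the bases.\<close>
    then have "\<not> W < q\<^sub>0 powr (- 1 / (p - 1)) * I"
      using powr_less_mono2_neg[of "1 - p" W] p1 W by force
    then show ?thesis by (simp add: I_def)
  qed
  \<comment> \<open>\<open>W\<close> depends on the outer sphere alone, so the inner radius
    \<open>s\<close> may tend to 0; its contribution vanishes because
    \<open>\<gamma> > 0\<close>.\<close>
  have "((\<lambda>s. q\<^sub>0 powr (- 1 / (p - 1)) * ((r powr \<gamma> - s powr \<gamma>) / \<gamma>)) \<longlongrightarrow>
      q\<^sub>0 powr (- 1 / (p - 1)) * ((r powr \<gamma> - 0 powr \<gamma>) / \<gamma>)) (at_right 0)"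
    using \<gamma> by (intro tendsto_intros) (auto intro: eventually_mono[OF eventually_at_right_less])
  moreover have "eventually (\<lambda>s. q\<^sub>0 powr (- 1 / (p - 1)) * ((r powr \<gamma> - s powr \<gamma>) / \<gamma>) \<le> W) (at_right 0)"
    using eventually_at_right_real[OF r(1)] by eventually_elim (use le in auto)
  ultimately have "q\<^sub>0 powr (- 1 / (p - 1)) * (r powr \<gamma> / \<gamma>) \<le> W"
    using tendsto_upperbound[of _ _ "at_right (0::real)"] by force
  then have "q\<^sub>0 powr (- 1 / (p - 1)) * (\<delta> / \<gamma>) * r powr \<gamma> \<le> L powr \<delta>"
    using \<gamma> \<delta> by (simp add: W_def field_simps)
  then have "(q\<^sub>0 powr (- 1 / (p - 1)) * (\<delta> / \<gamma>) * r powr \<gamma>) powr (1 / \<delta>) \<le> (L powr \<delta>) powr (1 / \<delta>)"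
    using \<gamma> \<delta> by (intro powr_mono2) auto
  also have "\<dots> = L" using L \<delta> by (simp add: powr_powr)
  also have "(q\<^sub>0 powr (- 1 / (p - 1)) * (\<delta> / \<gamma>) * r powr \<gamma>) powr (1 / \<delta>)
      = (\<delta> / \<gamma>) powr (1 / \<delta>) * q\<^sub>0 powr (- 1 / (p - 1) * (1 / \<delta>)) * r powr (\<gamma> * (1 / \<delta>))"
    using \<gamma> \<delta> by (simp only: powr_mult powr_powr mult_ac)
  also have "1 / \<delta> = (p - 1) / (p - ?n)" by (simp add: \<delta>_def)
  also have "\<gamma> * ((p - 1) / (p - ?n)) = (\<alpha> + p - ?n) / (p - ?n)" using p1 by (simp add: \<gamma>_def)
  also have "- 1 / (p - 1) * ((p - 1) / (p - ?n)) = 1 / (?n - p)"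
    using p1 p by (simp add: divide_simps)
  also have "\<delta> / \<gamma> = (p - ?n) / (\<alpha> + p - ?n)" using p1 by (simp add: \<delta>_def \<gamma>_def)
  finally show ?thesis using zr by (auto simp: L_def)
qed

theorem theorem2:
  fixes p q\<^sub>0 \<alpha> \<epsilon>\<^sub>0 :: real
    and Q :: "'a::euclidean_space \<Rightarrow> ennreal"
    and f :: "'a \<Rightarrow> 'a"
  assumes "2 \<le> DIM('a)"
    and "real DIM('a) < p"
    and "Q \<in> borel_measurable (lebesgue_on (ball 0 1))"
    and "ring_Q_homeomorphism p (ball 0 1) Q 0 f"
    and "f 0 = 0"
    and "0 < q\<^sub>0" and "0 \<le> \<alpha>" and "0 < \<epsilon>\<^sub>0" and "\<epsilon>\<^sub>0 < 1"
    and "AE t in lebesgue. t \<in> {0<..<\<epsilon>\<^sub>0} \<longrightarrow>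
           sphere_mean Q 0 t \<le> ennreal (q\<^sub>0 * t powr (- \<alpha>))"
  shows "ereal (((p - real DIM('a)) / (\<alpha> + p - real DIM('a)))
                   powr ((p - 1) / (p - real DIM('a)))
                 * q\<^sub>0 powr (1 / (real DIM('a) - p)))
         \<le> Limsup (at 0) (\<lambda>x. ereal (norm (f x) /
               norm x powr ((\<alpha> + p - real DIM('a)) / (p - real DIM('a)))))"
    (is "ereal ?c \<le> Limsup _ ?F")
  unfolding Limsup_def
proof (rule INF_greatest)
  fix P :: "'a \<Rightarrow> bool" assume "P \<in> {P. eventually P (at 0)}"
  then obtain d where d: "d > 0" "\<And>x. x \<noteq> 0 \<Longrightarrow> dist x 0 < d \<Longrightarrow> P x"
    by (auto simp: eventually_at)
  \<comment> \<open>The upper limit is an infimum of suprema over punctured neighbourhoods, so one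
    point \<open>z\<close> in each suffices; its norm is taken below both the size \<open>d\<close>
    of the neighbourhood and \<open>\<epsilon>\<^sub>0\<close>.\<close>
  define r where "r = min d \<epsilon>\<^sub>0 / 2"
  have r: "0 < r" "r < d" "r < \<epsilon>\<^sub>0" "r < 1"
    using d assms(8,9) by (auto simp: r_def)
  obtain z where z: "norm z = r"
    "?c * r powr ((\<alpha> + p - real DIM('a)) / (p - real DIM('a))) \<le> norm (f z)"
    using ring_Q_max_norm_lower_bound[OF assms(2-7,10) r(1,3,4)] by blast
  have "ereal ?c \<le> ?F z"
    using z r by (simp add: pos_le_divide_eq)
  also have "P z" using z r by (intro d) auto
  then have "?F z \<le> (SUP x\<in>Collect P. ?F x)"
    by (intro SUP_upper) simp
  finally show "ereal ?c \<le> (SUP x\<in>Collect P. ?F x)" .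
qed

end
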